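(* Let $d$ be a positive integer and $\epsilon>0$. Up to isomorphism there are only finitely many $d$-dimensional $\mathbb{Q}$-Gorenstein toric singularities $X$ with $\widehat{\operatorname{vol}}(X)>\epsilon$.
   Context: Let $N\cong\mathbb{Z}^d$ be a lattice, $M=\operatorname{Hom}(N,\mathbb{Z})$, with pairing $\langle\cdot,\cdot\rangle$; $N_\mathbb{R}=N\otimes\mathbb{R}$, $M_\mathbb{R}=M\otimes\mathbb{R}$. For a full-dimensional strictly convex rational polyhedral cone $\sigma\subset N_\mathbb{R}$ let $\sigma^\vee=\{m\in M_\mathbb{R}:\langle m,v\rangle\ge0\ \forall v\in\sigma\}$ and $X(\sigma)=\operatorname{Spec}\mathbb{K}[\sigma^\vee\cap M]$; the toric singularity $X=X(\sigma)$ is the germ of $X(\sigma)$ at its unique torus-fixed point. For each ray $\rho$ of $\sigma$ let $v_\rho\in N$ be its primitive generator. $X$ is $\mathbb{Q}$-Gorenstein iff there is $u\in M_\mathbb{Q}$ with $\langle u,v_\rho\rangle=1$ for all rays $\rho$. For $\xi\in N_\mathbb{R}$ put $\sigma^\vee(\xi)=\{m\in\sigma^\vee:\langle \xi,m\rangle\le1\}$. The normalized volume of a $\mathbb{Q}$-Gorenstein toric singularity is $\widehat{\operatorname{vol}}(X)=\min\{d!\,\operatorname{vol}(\sigma^\vee(\xi)) : \xi\in\operatorname{conv}\{v_\rho\}\}$, where $\operatorname{vol}$ is Lebesgue measure on $M_\mathbb{R}$ normalized so that $M$ has covolume $1$ (this coincides with Li's normalized volume $\inf_v a_X(v)^d\operatorname{vol}_X(v)$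 over valuations centered at the fixed point). *)

theory Defs
  imports "HOL-Analysis.Analysis"
begin

text \<open>N = Z^d realised as the integer points of real^'n (d = CARD('n)); M = Hom(N,Z)
  identified with Z^d via the dual basis, the pairing being the inner product.\<close>

definition lattice_point :: "real^'n \<Rightarrow> bool" where
  "lattice_point v \<longleftrightarrow> (\<forall>i. v $ i \<in> \<int>)"

text \<open>Full-dimensional strictly convex rational polyhedral cone.\<close>
definition toric_cone :: "(real^'n) set \<Rightarrow> bool" where
  "toric_cone \<sigma> \<longleftrightarrow>
     (\<exists>S. finite S \<and> (\<forall>v\<in>S. lattice_point v) \<and> \<sigma> = convex_cone hull S)
     \<and> \<sigma> \<inter> uminus ` \<sigma> = {0}
     \<and> interior \<sigma> \<noteq> {}"

text \<open>Primitive generators v_rho of the rays (one-dimensional faces) of sigma.\<close>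
definition ray_generators :: "(real^'n) set \<Rightarrow> (real^'n) set" where
  "ray_generators \<sigma> = {v. lattice_point v \<and> v \<noteq> 0
       \<and> (\<lambda>t. t *\<^sub>R v) ` {0..} face_of \<sigma>
       \<and> (\<forall>t::real. 0 < t \<and> t < 1 \<longrightarrow> \<not> lattice_point (t *\<^sub>R v))}"

definition Q_Gorenstein :: "(real^'n) set \<Rightarrow> bool" where
  "Q_Gorenstein \<sigma> \<longleftrightarrow>
     (\<exists>u::real^'n. (\<forall>i. u $ i \<in> \<rat>) \<and> (\<forall>v\<in>ray_generators \<sigma>. u \<bullet> v = 1))"

definition dual_cone :: "(real^'n) set \<Rightarrow> (real^'n) set" where
  "dual_cone \<sigma> = {m. \<forall>v\<in>\<sigma>. 0 \<le> m \<bullet> v}"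

definition truncated_dual :: "(real^'n) set \<Rightarrow> real^'n \<Rightarrow> (real^'n) set" where
  "truncated_dual \<sigma> \<xi> = {m \<in> dual_cone \<sigma>. \<xi> \<bullet> m \<le> 1}"

text \<open>Normalized volume (value +infinity allowed, hence ennreal; Lebesgue measure on
  real^'n gives Z^d covolume 1).\<close>
definition normalized_volume :: "(real^'n) set \<Rightarrow> ennreal" where
  "normalized_volume \<sigma> =
     (INF \<xi> \<in> convex hull (ray_generators \<sigma>).
        ennreal (fact CARD('n)) * emeasure lebesgue (truncated_dual \<sigma> \<xi>))"

text \<open>Isomorphism of toric singularities: cones equivalent under GL(N) = GL_d(Z).\<close>
definition toric_iso :: "(real^'n) set \<Rightarrow> (real^'n) set \<Rightarrow> bool" where
  "toric_iso \<sigma> \<tau> \<longleftrightarrow>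
     (\<exists>A::real^'n^'n. (\<forall>i j. A $ i $ j \<in> \<int>) \<and> \<bar>det A\<bar> = 1
        \<and> \<tau> = (\<lambda>x. A *v x) ` \<sigma>)"

end

theory Submission
  imports Defs
begin

text \<open>Choose ray generators g_1, ..., g_d of \<sigma> forming a basis and let \<xi> be their barycentre.
  The truncated dual of \<sigma> at \<xi> lies in the parallelepiped of all m with 0 \<le> g_i \<bullet> m \<le> d,
  whose volume is d^d / \<bar>det g\<bar>; hence a normalized volume above \<epsilon> forces
  \<bar>det g\<bar> < d! d^d / \<epsilon>, and by Cramer's rule the coordinates of every ray generator in the basis g
  obey the same bound. As det g divides K = \<lfloor>d! d^d / \<epsilon>\<rfloor>!, the lattice spanned by the rows of
  the matrix with columns g_i contains K \<int>^d and is determined by its points in [0, K)^d, so up to GL_d(\<int>) only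
  finitely many such matrices occur. After a unimodular change of coordinates all ray generators of
  \<sigma> lie in one fixed bounded box, which leaves finitely many cones.\<close>

section \<open>Lebesgue measure of linear images over arbitrary finite index types\<close>

text \<open>The library proves the determinant formula for the volume of a linear image only for index
  types of sort {finite, wellorder}; a well-ordered copy of the index type transports it to
  arbitrary finite index types.\<close>

typedef 'a wellordered = "UNIV :: 'a set" by simp

instance wellordered :: (finite) finite
proof
  show "finite (UNIV :: 'a wellordered set)"
    by (subst type_definition.Abs_image[OF type_definition_wellordered, symmetric]) simp
qed

instantiation wellordered :: (finite) wellorder
begin
definition less_eq_wellordered :: "'a wellordered \<Rightarrow> 'a wellordered \<Rightarrow> bool" where
  "x \<le> y \<longleftrightarrow> to_nat_on UNIV (Rep_wellordered x) \<le> to_nat_on UNIV (Rep_wellordered y)"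
definition less_wellordered :: "'a wellordered \<Rightarrow> 'a wellordered \<Rightarrow> bool" where
  "x < y \<longleftrightarrow> to_nat_on UNIV (Rep_wellordered x) < to_nat_on UNIV (Rep_wellordered y)"
instance
proof
  have inj: "inj (\<lambda>x::'a wellordered. to_nat_on UNIV (Rep_wellordered x))"
    using inj_on_to_nat_on[OF countable_finite[OF finite]]
    by (metis (mono_tags, lifting) Rep_wellordered_inject injD injI)
  show "x \<le> y \<Longrightarrow> y \<le> x \<Longrightarrow> x = y" for x y :: "'a wellordered"
    unfolding less_eq_wellordered_def using inj by (meson injD le_antisym)
  show "(\<And>x. (\<And>y. y < x \<Longrightarrow> P y) \<Longrightarrow> P x) \<Longrightarrow> P a" for P and a :: "'a wellordered"
    unfolding less_wellordered_def
    by (induct a rule: measure_induct_rule[where f = "\<lambda>x. to_nat_on UNIV (Rep_wellordered x)"]) blast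
qed (unfold less_eq_wellordered_def less_wellordered_def; linarith)+
end

lemma bij_Rep_wellordered: "bij Rep_wellordered"
  by (metis Abs_wellordered_inverse Rep_wellordered_inverse UNIV_I bij_betw_byWitness subset_UNIV image_subsetI)

lemma prod_Basis_cart: "(\<Prod>b\<in>Basis. f (x \<bullet> b)) = (\<Prod>i\<in>UNIV. f (x $ i))"
  for x :: "real^'n::finite"
  by (simp add: Basis_vec_def cart_eq_inner_axis axis_eq_axis prod.UNION_disjoint)

lemma emeasure_lborel_box_cart:
  fixes l u :: "real^'n::finite"
  shows "emeasure lborel (box l u) = (if \<forall>i. l $ i \<le> u $ i then \<Prod>i\<in>UNIV. u $ i - l $ i else 0)"
  by (simp add: emeasure_lborel_box_eq Basis_vec_def cart_eq_inner_axis axis_eq_axis prod.UNION_disjoint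
        inner_diff_left)

definition vec_reindex :: "('m \<Rightarrow> 'n) \<Rightarrow> 'a^'n \<Rightarrow> 'a^'m" where
  "vec_reindex \<pi> x = (\<chi> j. x $ \<pi> j)"

lemma vec_reindex_nth [simp]: "vec_reindex \<pi> x $ j = x $ \<pi> j"
  by (simp add: vec_reindex_def)

lemma linear_vec_reindex: "linear (vec_reindex \<pi> :: real^'n::finite \<Rightarrow> real^'m::finite)"
  by (rule linearI) (simp_all add: vec_eq_iff)

lemma vec_reindex_inv:
  assumes "bij \<pi>"
  shows "vec_reindex (inv \<pi>) (vec_reindex \<pi> x) = x" "vec_reindex \<pi> (vec_reindex (inv \<pi>) y) = y"
  using assms by (simp_all add: vec_eq_iff bij_is_surj surj_f_inv_f bij_is_inj)

lemma borel_measurable_vec_reindex: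
  "(vec_reindex \<pi> :: real^'n::finite \<Rightarrow> real^'m::finite) \<in> borel \<rightarrow>\<^sub>M borel"
  using linear_vec_reindex
  by (intro borel_measurable_continuous_onI linear_continuous_on) (simp add: linear_conv_bounded_linear)

lemma lborel_distr_vec_reindex:
  fixes \<pi> :: "'m::finite \<Rightarrow> 'n::finite"
  assumes "bij \<pi>"
  shows "distr lborel borel (vec_reindex \<pi> :: real^'n \<Rightarrow> real^'m) = lborel"
proof (rule lborel_eqI[symmetric])
  fix l u :: "real^'m"
  assume "\<And>b. b \<in> Basis \<Longrightarrow> l \<bullet> b \<le> u \<bullet> b"
  then have lu: "l $ j \<le> u $ j" for j
    by (auto simp: Basis_vec_def cart_eq_inner_axis)
  have inv1: "inv \<pi> (\<pi> j) = j" for j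
    using assms by (simp add: bij_is_inj)
  have inv2: "\<pi> (inv \<pi> i) = i" for i
    using assms by (simp add: bij_is_surj surj_f_inv_f)
  have "vec_reindex \<pi> -` box l u = box (vec_reindex (inv \<pi>) l) (vec_reindex (inv \<pi>) u)"
    unfolding mem_box_cart set_eq_iff vimage_eq vec_reindex_nth by (metis inv1 inv2)
  then have "emeasure (distr lborel borel (vec_reindex \<pi>)) (box l u)
      = emeasure lborel (box (vec_reindex (inv \<pi>) l) (vec_reindex (inv \<pi>) u))"
    using borel_measurable_vec_reindex[of \<pi>] by (simp add: emeasure_distr)
  also have "\<dots> = (\<Prod>i\<in>UNIV. u $ inv \<pi> i - l $ inv \<pi> i)"
    using lu by (simp add: emeasure_lborel_box_cart)
  also have "\<dots> = (\<Prod>j\<in>UNIV. u $ j - l $ j)"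
    using prod.reindex_bij_betw[OF bij_betw_inv_into[OF assms], of "\<lambda>j. u $ j - l $ j"] by simp
  also have "\<dots> = (\<Prod>b\<in>Basis. (u - l) \<bullet> b)"
    using prod_Basis_cart[of "\<lambda>t. t" "u - l"] by simp
  finally show "emeasure (distr lborel borel (vec_reindex \<pi>)) (box l u) = (\<Prod>b\<in>Basis. (u - l) \<bullet> b)" .
qed (rule sets_distr)

lemma measure_vec_reindex_vimage:
  fixes \<pi> :: "'m::finite \<Rightarrow> 'n::finite" and S :: "(real^'m) set"
  assumes "bij \<pi>" and S: "S \<in> sets borel"
  shows "measure lebesgue (vec_reindex \<pi> -` S) = measure lebesgue S"
proof -
  note meas = borel_measurable_vec_reindex[of \<pi>]
  have "vec_reindex \<pi> -` S \<in> sets borel"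
    using measurable_sets[OF meas S] by simp
  then have "measure lebesgue (vec_reindex \<pi> -` S) = measure (distr lborel borel (vec_reindex \<pi>)) S"
    using meas S by (simp add: measure_distr)
  then show ?thesis
    using S by (simp add: lborel_distr_vec_reindex[OF assms(1)])
qed

lemma det_reindex:
  fixes A :: "'a::comm_ring_1^'n::finite^'n" and \<pi> :: "'m::finite \<Rightarrow> 'n"
  assumes "bij \<pi>"
  shows "det (\<chi> i j. A $ \<pi> i $ \<pi> j) = det A"
proof -
  let ?conj = "map_permutation UNIV \<pi>" and ?unconj = "map_permutation UNIV (inv \<pi>)"
  have inj: "inj \<pi>" and bij_inv: "bij (inv \<pi>)"
    using assms by (simp_all add: bij_is_inj bij_imp_bij_inv)
  have term_eq: "of_int (sign (?conj q)) * (\<Prod>k\<in>UNIV. A $ k $ ?conj q k)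
      = of_int (sign q) * (\<Prod>i\<in>UNIV. A $ \<pi> i $ \<pi> (q i))"
    if q: "q permutes UNIV" for q
  proof -
    have "sign (?conj q) = sign q"
      using inj q by (simp add: sign_map_permutation)
    moreover have "(\<Prod>k\<in>UNIV. A $ k $ ?conj q k) = (\<Prod>i\<in>UNIV. A $ \<pi> i $ ?conj q (\<pi> i))"
      using prod.reindex_bij_betw[OF assms, of "\<lambda>k. A $ k $ ?conj q k"] by simp
    ultimately show ?thesis
      using inj by (simp add: map_permutation_apply)
  qed
  have "det (\<chi> i j. A $ \<pi> i $ \<pi> j)
      = (\<Sum>q | q permutes UNIV. of_int (sign q) * (\<Prod>i\<in>UNIV. A $ \<pi> i $ \<pi> (q i)))"
    by (simp add: det_def)
  also have "\<dots> = (\<Sum>p | p permutes UNIV. of_int (sign p) * (\<Prod>k\<in>UNIV. A $ k $ p k))"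
  proof (rule sum.reindex_bij_witness[where i = ?unconj and j = ?conj])
    show "?unconj (?conj q) = q" if "q \<in> {q. q permutes UNIV}" for q
      using that assms inj by (intro map_permutation_compose_inv) auto
    show "?conj (?unconj p) = p" if "p \<in> {p. p permutes UNIV}" for p
      using that bij_inv assms by (intro map_permutation_compose_inv) (auto simp: bij_is_surj surj_f_inv_f)
  qed (use assms bij_inv term_eq in \<open>auto intro: map_permutation_permutes\<close>)
  also have "\<dots> = det A"
    by (simp add: det_def)
  finally show ?thesis .
qed

lemma compact_linear_image:
  fixes f :: "'a::euclidean_space \<Rightarrow> 'b::real_normed_vector"
  shows "linear f \<Longrightarrow> compact S \<Longrightarrow> compact (f ` S)"
  by (intro compact_continuous_image linear_continuous_on) (simp_all add: linear_conv_bounded_linear)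

lemma measure_linear_image_compact:
  fixes f :: "real^'n::finite \<Rightarrow> real^'n"
  assumes f: "linear f" and K: "compact K"
  shows "measure lebesgue (f ` K) = \<bar>det (matrix f)\<bar> * measure lebesgue K"
proof -
  let ?\<pi> = "Rep_wellordered :: 'n wellordered \<Rightarrow> 'n"
  let ?\<Phi> = "vec_reindex ?\<pi> :: real^'n \<Rightarrow> real^'n wellordered"
  let ?\<Psi> = "vec_reindex (inv ?\<pi>) :: real^'n wellordered \<Rightarrow> real^'n"
  define g where "g = ?\<Phi> \<circ> f \<circ> ?\<Psi>"
  note inv = vec_reindex_inv[OF bij_Rep_wellordered]
  have \<Phi>_image: "?\<Phi> ` X = ?\<Psi> -` X" for X
  proof
    show "?\<Phi> ` X \<subseteq> ?\<Psi> -` X"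
      using inv by auto
    show "?\<Psi> -` X \<subseteq> ?\<Phi> ` X"
    proof
      fix y assume "y \<in> ?\<Psi> -` X"
      then show "y \<in> ?\<Phi> ` X"
        by (intro image_eqI[of _ _ "?\<Psi> y"]) (simp_all add: inv)
    qed
  qed
  have \<Phi>_measure: "measure lebesgue (?\<Phi> ` X) = measure lebesgue X" if "compact X" for X
    unfolding \<Phi>_image using that
    by (intro measure_vec_reindex_vimage bij_imp_bij_inv bij_Rep_wellordered) (simp add: compact_imp_closed)
  have lin_g: "linear g"
    unfolding g_def by (intro linear_compose f linear_vec_reindex)
  have "matrix g = (\<chi> i j. matrix f $ ?\<pi> i $ ?\<pi> j)"
  proof -
    have "inv ?\<pi> i = j \<longleftrightarrow> i = ?\<pi> j" for i j
      using bij_inv_eq_iff[OF bij_Rep_wellordered, of j i] by auto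
    then have axis: "?\<Psi> (axis j 1) = axis (?\<pi> j) 1" for j
      by (simp add: vec_eq_iff axis_def)
    show ?thesis
      by (simp add: matrix_def g_def axis)
  qed
  then have det_g: "det (matrix g) = det (matrix f)"
    by (simp add: det_reindex bij_Rep_wellordered)
  have "?\<Phi> ` f ` K = g ` ?\<Phi> ` K"
    by (simp add: g_def image_comp o_def inv)
  then have "measure lebesgue (f ` K) = measure lebesgue (g ` ?\<Phi> ` K)"
    using \<Phi>_measure compact_linear_image[OF f K] by metis
  also have "\<dots> = \<bar>det (matrix g)\<bar> * measure lebesgue (?\<Phi> ` K)"
    by (rule measure_linear_image[OF lin_g lmeasurable_compact[OF compact_linear_image[OF linear_vec_reindex K]]])
  also have "\<dots> = \<bar>det (matrix f)\<bar> * measure lebesgue K"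
    by (simp add: det_g \<Phi>_measure K)
  finally show ?thesis .
qed

section \<open>Cones and their ray generators\<close>

lemma ray_generators_subset: "ray_generators \<sigma> \<subseteq> \<sigma>"
proof
  fix v assume "v \<in> ray_generators \<sigma>"
  then have "(\<lambda>t. t *\<^sub>R v) ` {0..} \<subseteq> \<sigma>"
    unfolding ray_generators_def by (blast dest: face_of_imp_subset)
  moreover have "v \<in> (\<lambda>t. t *\<^sub>R v) ` {0..}"
    by (rule image_eqI[of _ _ 1]) auto
  ultimately show "v \<in> \<sigma>" by blast
qed

lemma lattice_point_ray_generator: "v \<in> ray_generators \<sigma> \<Longrightarrow> lattice_point v"
  by (simp add: ray_generators_def)

lemma pointed_cone_add_eq_0:
  fixes x :: "'a::ab_group_add"
  assumes "\<sigma> \<inter> uminus ` \<sigma> = {0}" "x \<in> \<sigma>" "y \<in> \<sigma>" "x + y = 0"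
  shows "x = 0"
proof -
  have "x = - y" using assms(4) by (simp add: eq_neg_iff_add_eq_0)
  then have "x \<in> uminus ` \<sigma>" using assms(3) by blast
  then show ?thesis using assms(1,2) by blast
qed

lemma convex_cone_hull_singleton: "convex_cone hull {s} = (\<lambda>t. t *\<^sub>R s) ` {0..}"
  by (auto simp: convex_cone_hull_convex_hull_nonempty)

lemma mem_convex_cone_hull_insertE:
  fixes s :: "'a::real_vector"
  assumes "y \<in> convex_cone hull (insert s T)"
  obtains \<alpha> z where "0 \<le> \<alpha>" "z \<in> convex_cone hull T" "y = \<alpha> *\<^sub>R s + z"
proof -
  have "convex_cone hull (insert s T) = (\<Union>x \<in> convex_cone hull {s}. \<Union>y \<in> convex_cone hull T. {x + y})"
    by (metis convex_cone_hull_Un insert_is_Un)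
  then show thesis
    using assms that unfolding convex_cone_hull_singleton by auto
qed

lemma ray_face_of_convex_cone_hull:
  fixes s :: "'a::real_vector"
  assumes \<sigma>: "\<sigma> = convex_cone hull T" and pointed: "\<sigma> \<inter> uminus ` \<sigma> = {0}"
    and s: "s \<in> T" and redundant: "s \<notin> convex_cone hull (T - {s})"
  shows "(\<lambda>t. t *\<^sub>R s) ` {0..} face_of \<sigma>"
proof -
  define H where "H = convex_cone hull (T - {s})"
  have H_sub: "H \<subseteq> \<sigma>" unfolding H_def \<sigma> by (rule hull_mono) auto
  have s_in: "s \<in> \<sigma>" unfolding \<sigma> using s by (rule hull_inc)
  have "\<sigma> = convex_cone hull (insert s (T - {s}))" using s \<sigma> by (simp add: insert_absorb)
  then have decomp: "\<exists>\<alpha> z. 0 \<le> \<alpha> \<and> z \<in> H \<and> y = \<alpha> *\<^sub>R s + z" if "y \<in> \<sigma>" for y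
    using that unfolding H_def by (metis mem_convex_cone_hull_insertE)
  have mul: "c *\<^sub>R x \<in> \<sigma>" if "x \<in> \<sigma>" "0 \<le> c" for x c
    using that \<sigma> by (simp add: convex_cone_hull_mul)
  show ?thesis
    unfolding face_of_def
  proof (intro conjI ballI impI)
    show "(\<lambda>t. t *\<^sub>R s) ` {0..} \<subseteq> \<sigma>" using s_in mul by auto
    show "convex ((\<lambda>t. t *\<^sub>R s) ` {0..})"
      by (metis convex_cone_hull_singleton convex_convex_cone_hull)
    fix a b x
    assume a: "a \<in> \<sigma>" and b: "b \<in> \<sigma>" and "x \<in> (\<lambda>t. t *\<^sub>R s) ` {0..}" and "x \<in> open_segment a b"
    then obtain t u where t: "t \<ge> 0" "x = t *\<^sub>R s" and u: "0 < u" "u < 1" "x = (1 - u) *\<^sub>R a + u *\<^sub>R b"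
      by (auto simp: in_segment)
    obtain \<alpha>a za where A: "0 \<le> \<alpha>a" "za \<in> H" "a = \<alpha>a *\<^sub>R s + za" using decomp[OF a] by blast
    obtain \<alpha>b zb where B: "0 \<le> \<alpha>b" "zb \<in> H" "b = \<alpha>b *\<^sub>R s + zb" using decomp[OF b] by blast
    define \<gamma> where "\<gamma> = (1 - u) * \<alpha>a + u * \<alpha>b"
    define z where "z = (1 - u) *\<^sub>R za + u *\<^sub>R zb"
    have zH: "z \<in> H" unfolding z_def H_def using A B u
      by (intro convex_cone_hull_add convex_cone_hull_mul) (auto simp: H_def)
    have eq: "t *\<^sub>R s = \<gamma> *\<^sub>R s + z"
      using t u A B by (simp add: \<gamma>_def z_def algebra_simps)
    txt \<open>Otherwise s would be a positive multiple of z and hence lie in H.\<close>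
    have "t \<le> \<gamma>"
    proof (rule ccontr)
      assume "\<not> t \<le> \<gamma>"
      have "z = (t - \<gamma>) *\<^sub>R s"
        by (simp add: eq algebra_simps)
      with \<open>\<not> t \<le> \<gamma>\<close> have "s = (1 / (t - \<gamma>)) *\<^sub>R z"
        by simp
      then have "s \<in> H" using zH \<open>\<not> t \<le> \<gamma>\<close> unfolding H_def by (simp add: convex_cone_hull_mul)
      then show False using redundant H_def by simp
    qed
    have "(\<gamma> - t) *\<^sub>R s + z = 0"
      using eq by (simp add: algebra_simps)
    moreover have "(\<gamma> - t) *\<^sub>R s \<in> \<sigma>"
      using \<open>t \<le> \<gamma>\<close> s_in mul by simp
    ultimately have "z = 0"
      using pointed_cone_add_eq_0[OF pointed] zH H_sub by (metis add_0_left subsetD)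
    moreover have "(1 - u) *\<^sub>R za \<in> \<sigma>" "u *\<^sub>R zb \<in> \<sigma>"
      using A B H_sub u mul by auto
    ultimately have "(1 - u) *\<^sub>R za = 0" "u *\<^sub>R zb = 0"
      using pointed_cone_add_eq_0[OF pointed] by (metis z_def add.commute)+
    then have "za = 0" "zb = 0" using u by auto
    then show "a \<in> (\<lambda>t. t *\<^sub>R s) ` {0..}" "b \<in> (\<lambda>t. t *\<^sub>R s) ` {0..}"
      using A B by auto
  qed
qed

lemma ex_minimal_conic_generators:
  assumes "finite S"
  obtains T where "T \<subseteq> S" "convex_cone hull T = convex_cone hull S"
    "\<And>s. s \<in> T \<Longrightarrow> s \<notin> convex_cone hull (T - {s})"
proof -
  let ?P = "\<lambda>T. T \<subseteq> S \<and> convex_cone hull T = convex_cone hull S"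
  obtain T where T: "?P T" and min: "\<And>T'. ?P T' \<Longrightarrow> card T \<le> card T'"
    using ex_has_least_nat[of ?P S card] by auto
  have "finite T" using T assms finite_subset by blast
  have "s \<notin> convex_cone hull (T - {s})" if "s \<in> T" for s
  proof
    assume "s \<in> convex_cone hull (T - {s})"
    then have "convex_cone hull (insert s (T - {s})) = convex_cone hull (T - {s})"
      by (rule hull_redundant)
    then have "?P (T - {s})" using T that by (metis insert_Diff Diff_subset order_trans)
    then have "card T \<le> card (T - {s})" by (rule min)
    moreover have "card (T - {s}) < card T" using \<open>finite T\<close> that by (meson card_Diff1_less)
    ultimately show False by simp
  qed
  with T that show thesis by blast
qed

lemma ex_primitive_multiple:
  fixes s :: "real^'n::finite"
  assumes "lattice_point s" and "s \<noteq> 0"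
  obtains \<tau> where "\<tau> > 0" "lattice_point (\<tau> *\<^sub>R s)"
    "\<And>t. 0 < t \<Longrightarrow> t < 1 \<Longrightarrow> \<not> lattice_point (t *\<^sub>R \<tau> *\<^sub>R s)"
proof -
  obtain i where si: "s $ i \<noteq> 0" using assms(2) by (auto simp: vec_eq_iff)
  define Ts where "Ts = {t::real. 0 < t \<and> t \<le> 1 \<and> lattice_point (t *\<^sub>R s)}"
  define N where "N = \<lceil>\<bar>s $ i\<bar>\<rceil>"
  have "Ts \<subseteq> (\<lambda>k. of_int k / s $ i) ` {-N..N}"
  proof
    fix t assume t: "t \<in> Ts"
    then obtain k where k: "t * s $ i = of_int k" by (auto simp: Ts_def lattice_point_def elim: Ints_cases)
    have "\<bar>of_int k\<bar> \<le> \<bar>s $ i\<bar>"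
      using t k[symmetric] by (auto simp: Ts_def abs_mult intro!: mult_left_le_one_le)
    then have "\<bar>k\<bar> \<le> N" unfolding N_def by linarith
    moreover have "t = of_int k / s $ i" using k si by (simp add: field_simps)
    ultimately show "t \<in> (\<lambda>k. of_int k / s $ i) ` {-N..N}" by (intro image_eqI[of _ _ k]) auto
  qed
  then have "finite Ts" using finite_subset by blast
  moreover have "1 \<in> Ts" using assms(1) by (simp add: Ts_def)
  ultimately have \<tau>: "Min Ts \<in> Ts" and least: "\<And>t. t \<in> Ts \<Longrightarrow> Min Ts \<le> t"
    by (auto intro: Min_in)
  show thesis
  proof (rule that)
    show "Min Ts > 0" "lattice_point (Min Ts *\<^sub>R s)" using \<tau> by (auto simp: Ts_def)
    fix t :: real assume t: "0 < t" "t < 1"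
    show "\<not> lattice_point (t *\<^sub>R Min Ts *\<^sub>R s)"
    proof
      assume "lattice_point (t *\<^sub>R Min Ts *\<^sub>R s)"
      then have "t * Min Ts \<in> Ts" using t \<tau> by (auto simp: Ts_def mult_le_one)
      then have "Min Ts \<le> t * Min Ts" by (rule least)
      moreover have "t * Min Ts < Min Ts" using t \<tau> by (simp add: Ts_def)
      ultimately show False by simp
    qed
  qed
qed

lemma scaleR_ray_eq:
  fixes s :: "'a::real_vector"
  assumes "\<tau> > 0"
  shows "(\<lambda>t. t *\<^sub>R (\<tau> *\<^sub>R s)) ` {0..} = (\<lambda>t. t *\<^sub>R s) ` {0..}"
proof (intro set_eqI iffI)
  fix x assume "x \<in> (\<lambda>t. t *\<^sub>R (\<tau> *\<^sub>R s)) ` {0..}"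
  then obtain t :: real where "t \<ge> 0" "x = t *\<^sub>R \<tau> *\<^sub>R s" by auto
  then show "x \<in> (\<lambda>t. t *\<^sub>R s) ` {0..}" using assms by (intro image_eqI[of _ _ "t * \<tau>"]) (auto simp: scaleR_scaleR)
next
  fix x assume "x \<in> (\<lambda>t. t *\<^sub>R s) ` {0..}"
  then obtain t where t: "t \<ge> 0" "x = t *\<^sub>R s" by auto
  then have "x = (t / \<tau>) *\<^sub>R (\<tau> *\<^sub>R s)" using assms by simp
  then show "x \<in> (\<lambda>t. t *\<^sub>R (\<tau> *\<^sub>R s)) ` {0..}" using assms t by (intro image_eqI[of _ _ "t / \<tau>"]) auto
qed

lemma ray_generator_multiple_of_minimal_generator:
  fixes s :: "real^'n::finite"
  assumes \<sigma>: "\<sigma> = convex_cone hull T" and pointed: "\<sigma> \<inter> uminus ` \<sigma> = {0}"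
    and s: "s \<in> T" "lattice_point s" and redundant: "s \<notin> convex_cone hull (T - {s})"
  obtains \<tau> where "\<tau> > 0" "\<tau> *\<^sub>R s \<in> ray_generators \<sigma>"
proof -
  have "s \<noteq> 0" using redundant convex_cone_hull_contains_0 by metis
  then obtain \<tau> where \<tau>: "\<tau> > 0" "lattice_point (\<tau> *\<^sub>R s)"
    "\<And>t. 0 < t \<Longrightarrow> t < 1 \<Longrightarrow> \<not> lattice_point (t *\<^sub>R \<tau> *\<^sub>R s)"
    using ex_primitive_multiple[OF s(2)] by blast
  have "(\<lambda>t. t *\<^sub>R (\<tau> *\<^sub>R s)) ` {0..} face_of \<sigma>"
    using ray_face_of_convex_cone_hull[OF \<sigma> pointed s(1) redundant] unfolding scaleR_ray_eq[OF \<tau>(1)] .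
  with \<tau> \<open>s \<noteq> 0\<close> have "\<tau> *\<^sub>R s \<in> ray_generators \<sigma>"
    by (simp add: ray_generators_def)
  with \<tau>(1) that show thesis by blast
qed

lemma toric_cone_ray_generators_hull:
  assumes "toric_cone \<sigma>"
  shows "convex_cone hull (ray_generators \<sigma>) = \<sigma>"
proof -
  obtain S where S: "finite S" "\<forall>v\<in>S. lattice_point v" "\<sigma> = convex_cone hull S"
    and pointed: "\<sigma> \<inter> uminus ` \<sigma> = {0}"
    using assms unfolding toric_cone_def by blast
  obtain T where T: "T \<subseteq> S" "convex_cone hull T = \<sigma>" "\<And>s. s \<in> T \<Longrightarrow> s \<notin> convex_cone hull (T - {s})"
    using ex_minimal_conic_generators[OF S(1)] S(3) by metis
  have "T \<subseteq> convex_cone hull (ray_generators \<sigma>)"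
  proof
    fix s assume s: "s \<in> T"
    obtain \<tau> where \<tau>: "\<tau> > 0" "\<tau> *\<^sub>R s \<in> ray_generators \<sigma>"
      using ray_generator_multiple_of_minimal_generator[OF T(2)[symmetric] pointed s _ T(3)[OF s]] S(2) T(1) s
      by blast
    then have "(1 / \<tau>) *\<^sub>R (\<tau> *\<^sub>R s) \<in> convex_cone hull (ray_generators \<sigma>)"
      by (intro convex_cone_hull_mul hull_inc) auto
    with \<tau>(1) show "s \<in> convex_cone hull (ray_generators \<sigma>)" by simp
  qed
  then have "\<sigma> \<subseteq> convex_cone hull (ray_generators \<sigma>)"
    using T(2) by (metis hull_minimal convex_cone_convex_cone_hull)
  moreover have "convex_cone hull (ray_generators \<sigma>) \<subseteq> \<sigma>"
    using ray_generators_subset T(2) by (metis hull_minimal convex_cone_convex_cone_hull)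
  ultimately show ?thesis by blast
qed

lemma span_ray_generators:
  fixes \<sigma> :: "(real^'n::finite) set"
  assumes "toric_cone \<sigma>"
  shows "span (ray_generators \<sigma>) = UNIV"
proof -
  have "interior \<sigma> \<noteq> {}" using assms by (simp add: toric_cone_def)
  then have "affine hull \<sigma> = UNIV"
    by (intro affine_hull_UNIV aff_dim_nonempty_interior)
  moreover have "affine hull \<sigma> \<subseteq> span \<sigma>" by (rule affine_hull_subset_span)
  moreover have "\<sigma> \<subseteq> span (ray_generators \<sigma>)"
    using toric_cone_ray_generators_hull[OF assms]
    by (metis hull_minimal convex_cone_span span_superset)
  ultimately show ?thesis
    by (metis span_span span_mono top.extremum_uniqueI)
qed

section \<open>Bounding the normalized volume by a determinant\<close>

definition column_matrix :: "('n::finite \<Rightarrow> real^'m) \<Rightarrow> real^'n^'m" where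
  "column_matrix g = (\<chi> i j. g j $ i)"

lemma transpose_column_matrix_mult: "transpose (column_matrix g) *v m = (\<chi> i. g i \<bullet> m)"
  by (simp add: vec_eq_iff column_matrix_def matrix_vector_mult_def transpose_def inner_vec_def)

lemma ex_invertible_column_matrix:
  fixes R :: "(real^'n::finite) set"
  assumes "span R = UNIV"
  obtains g where "\<And>i. g i \<in> R" "det (column_matrix g) \<noteq> 0"
proof -
  obtain B where B: "B \<subseteq> R" "independent B" "R \<subseteq> span B" "card B = dim R"
    using basis_exists by blast
  have "card B = CARD('n)"
    using B(4) assms by (metis dim_UNIV dim_span DIM_cart DIM_real mult_1_right)
  moreover have fin: "finite B" using B(2) by (simp add: finiteI_independent)
  ultimately obtain h where h: "bij_betw h (UNIV::'n set) B"
    using finite_same_card_bij[of "UNIV::'n set" B] by auto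
  have "c = (\<lambda>_. 0)" if c: "(\<Sum>i\<in>UNIV. c i *\<^sub>R h i) = 0" for c
  proof (rule ccontr)
    assume "c \<noteq> (\<lambda>_. 0)"
    then obtain i0 where i0: "c i0 \<noteq> 0" by auto
    define u where "u v = c (inv_into UNIV h v)" for v
    have "(\<Sum>v\<in>B. u v *\<^sub>R v) = (\<Sum>i\<in>UNIV. u (h i) *\<^sub>R h i)"
      by (rule sum.reindex_bij_betw[OF h, symmetric])
    also have "\<dots> = 0"
      using h c by (simp add: u_def bij_betw_def)
    finally have "dependent B"
      using fin h i0 by (auto simp: dependent_finite u_def bij_betw_def intro!: exI[of _ u] bexI[of _ "h i0"])
    then show False using B(2) by simp
  qed
  then have "\<exists>C. C ** column_matrix h = mat 1"
    unfolding matrix_left_invertible_independent_columns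
    by (simp add: column_def column_matrix_def scalar_mult_eq_scaleR fun_eq_iff)
  then have "det (column_matrix h) \<noteq> 0"
    using invertible_det_nz invertible_left_inverse by blast
  moreover have "\<And>i. h i \<in> R" using h B(1) by (auto simp: bij_betw_def)
  ultimately show thesis using that by blast
qed

lemma truncated_dual_barycentre_subset:
  fixes g :: "'n::finite \<Rightarrow> real^'n"
  assumes g: "\<And>i. g i \<in> \<sigma>"
  shows "truncated_dual \<sigma> (\<Sum>i\<in>UNIV. (1 / real CARD('n)) *\<^sub>R g i)
    \<subseteq> {m. \<forall>i. 0 \<le> g i \<bullet> m \<and> g i \<bullet> m \<le> real CARD('n)}"
proof
  fix m assume m: "m \<in> truncated_dual \<sigma> (\<Sum>i\<in>UNIV. (1 / real CARD('n)) *\<^sub>R g i)"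
  have nonneg: "0 \<le> g j \<bullet> m" for j
    using m g by (force simp: truncated_dual_def dual_cone_def inner_commute)
  have "(\<Sum>j\<in>UNIV. g j \<bullet> m) / real CARD('n) = (\<Sum>j\<in>UNIV. (1 / real CARD('n)) *\<^sub>R g j) \<bullet> m"
    by (simp add: inner_sum_left sum_divide_distrib)
  also have "\<dots> \<le> 1"
    using m by (simp add: truncated_dual_def)
  finally have "(\<Sum>j\<in>UNIV. g j \<bullet> m) \<le> real CARD('n)"
    by (simp add: divide_le_eq)
  then have "g i \<bullet> m \<le> real CARD('n)" for i
    using nonneg by (meson order_trans member_le_sum finite UNIV_I)
  with nonneg show "m \<in> {m. \<forall>i. 0 \<le> g i \<bullet> m \<and> g i \<bullet> m \<le> real CARD('n)}"
    by blast
qed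

lemma
  fixes g :: "'n::finite \<Rightarrow> real^'n"
  assumes det: "det (column_matrix g) \<noteq> 0" and c: "0 \<le> c"
  shows lmeasurable_dual_parallelepiped: "{m. \<forall>i. 0 \<le> g i \<bullet> m \<and> g i \<bullet> m \<le> c} \<in> lmeasurable"
    and emeasure_dual_parallelepiped: "emeasure lebesgue {m. \<forall>i. 0 \<le> g i \<bullet> m \<and> g i \<bullet> m \<le> c}
      = ennreal (c ^ CARD('n) / \<bar>det (column_matrix g)\<bar>)"
proof -
  let ?G = "transpose (column_matrix g)"
  obtain C where C: "?G ** C = mat 1" "C ** ?G = mat 1"
    using det invertible_det_nz[of ?G] unfolding invertible_def by auto
  have eq: "{m. \<forall>i. 0 \<le> g i \<bullet> m \<and> g i \<bullet> m \<le> c} = (*v) C ` cbox 0 (\<chi> i. c)"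
  proof (intro set_eqI iffI)
    fix m assume "m \<in> {m. \<forall>i. 0 \<le> g i \<bullet> m \<and> g i \<bullet> m \<le> c}"
    then have "?G *v m \<in> cbox 0 (\<chi> i. c)"
      by (simp add: transpose_column_matrix_mult mem_box_cart del: transpose_matrix_vector)
    moreover have "m = C *v (?G *v m)"
      by (simp only: matrix_vector_mul_assoc C matrix_vector_mul_lid)
    ultimately show "m \<in> (*v) C ` cbox 0 (\<chi> i. c)" by blast
  next
    fix m assume "m \<in> (*v) C ` cbox 0 (\<chi> i. c)"
    then obtain y where y: "y \<in> cbox 0 (\<chi> i. c)" and m: "m = C *v y" by blast
    have "?G *v m = y"
      unfolding m by (simp only: matrix_vector_mul_assoc C matrix_vector_mul_lid)
    then have "g i \<bullet> m = y $ i" for i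
      by (metis transpose_column_matrix_mult vec_lambda_beta)
    with y show "m \<in> {m. \<forall>i. 0 \<le> g i \<bullet> m \<and> g i \<bullet> m \<le> c}"
      by (simp add: mem_box_cart)
  qed
  have meas: "(*v) C ` cbox 0 (\<chi> i. c) \<in> lmeasurable"
    by (intro lmeasurable_compact compact_linear_image matrix_vector_mul_linear compact_cbox)
  then show "{m. \<forall>i. 0 \<le> g i \<bullet> m \<and> g i \<bullet> m \<le> c} \<in> lmeasurable"
    unfolding eq .
  have "det C * det (column_matrix g) = 1"
    using C(2) by (metis det_I det_mul det_transpose)
  then have "\<bar>det C\<bar> = 1 / \<bar>det (column_matrix g)\<bar>"
    by (simp add: abs_mult[symmetric] eq_divide_eq det)
  then have "measure lebesgue ((*v) C ` cbox 0 (\<chi> i. c)) = c ^ CARD('n) / \<bar>det (column_matrix g)\<bar>"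
    using c by (simp add: measure_linear_image_compact matrix_vector_mul_linear content_cbox_cart
        interval_ne_empty_cart prod_constant)
  then show "emeasure lebesgue {m. \<forall>i. 0 \<le> g i \<bullet> m \<and> g i \<bullet> m \<le> c}
      = ennreal (c ^ CARD('n) / \<bar>det (column_matrix g)\<bar>)"
    unfolding eq using meas by (simp add: emeasure_eq_measure2)
qed

lemma normalized_volume_le_det:
  fixes \<sigma> :: "(real^'n::finite) set"
  assumes g: "\<And>i. g i \<in> ray_generators \<sigma>" and det: "det (column_matrix g) \<noteq> 0"
  shows "normalized_volume \<sigma> \<le> ennreal (fact CARD('n) * real CARD('n) ^ CARD('n) / \<bar>det (column_matrix g)\<bar>)"
proof -
  define \<xi> where "\<xi> = (\<Sum>i\<in>UNIV. (1 / real CARD('n)) *\<^sub>R g i)"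
  have "\<xi> \<in> convex hull (ray_generators \<sigma>)"
    unfolding \<xi>_def by (rule convex_sum) (use g in \<open>auto simp: hull_inc\<close>)
  then have "normalized_volume \<sigma> \<le> ennreal (fact CARD('n)) * emeasure lebesgue (truncated_dual \<sigma> \<xi>)"
    unfolding normalized_volume_def by (rule INF_lower)
  also have "\<dots> \<le> ennreal (fact CARD('n)) * emeasure lebesgue {m. \<forall>i. 0 \<le> g i \<bullet> m \<and> g i \<bullet> m \<le> real CARD('n)}"
    using g ray_generators_subset det unfolding \<xi>_def
    by (intro mult_left_mono emeasure_mono truncated_dual_barycentre_subset)
      (auto intro: fmeasurableD[OF lmeasurable_dual_parallelepiped[OF det]])
  also have "\<dots> = ennreal (fact CARD('n) * real CARD('n) ^ CARD('n) / \<bar>det (column_matrix g)\<bar>)"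
    by (subst emeasure_dual_parallelepiped[OF det]) (simp_all add: ennreal_mult[symmetric])
  finally show ?thesis .
qed

section \<open>Integer matrices and their row lattices\<close>

definition int_matrix :: "real^'n^'m \<Rightarrow> bool" where
  "int_matrix M \<longleftrightarrow> (\<forall>i j. M $ i $ j \<in> \<int>)"

definition row_lattice :: "real^'n^'m \<Rightarrow> (real^'n) set" where
  "row_lattice M = {z v* M | z. lattice_point z}"

lemma lattice_point_add: "lattice_point a \<Longrightarrow> lattice_point b \<Longrightarrow> lattice_point (a + b)"
  by (simp add: lattice_point_def)

lemma lattice_point_diff: "lattice_point a \<Longrightarrow> lattice_point b \<Longrightarrow> lattice_point (a - b)"
  by (simp add: lattice_point_def)

lemma lattice_point_matrix_vector_mult:
  "int_matrix A \<Longrightarrow> lattice_point x \<Longrightarrow> lattice_point (A *v x)"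
  by (auto simp: lattice_point_def int_matrix_def matrix_vector_mult_def intro!: Ints_sum Ints_mult)

lemma lattice_point_vector_matrix_mult:
  "int_matrix A \<Longrightarrow> lattice_point x \<Longrightarrow> lattice_point (x v* A)"
  by (auto simp: lattice_point_def int_matrix_def vector_matrix_mult_def intro!: Ints_sum Ints_mult)

lemma vector_matrix_left_distrib: "(a + b) v* M = a v* M + b v* (M :: real^'n^'m::finite)"
  by (simp add: vec_eq_iff vector_matrix_mult_def sum.distrib algebra_simps)

lemma vector_matrix_diff_distrib: "(a - b) v* M = a v* M - b v* (M :: real^'n^'m::finite)"
  by (simp add: vec_eq_iff vector_matrix_mult_def sum_subtractf left_diff_distrib)

lemma row_lattice_add: "x \<in> row_lattice M \<Longrightarrow> y \<in> row_lattice M \<Longrightarrow> x + y \<in> row_lattice M"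
  unfolding row_lattice_def by (auto simp flip: vector_matrix_left_distrib intro: lattice_point_add)

lemma row_lattice_diff: "x \<in> row_lattice M \<Longrightarrow> y \<in> row_lattice M \<Longrightarrow> x - y \<in> row_lattice M"
  unfolding row_lattice_def by (auto simp flip: vector_matrix_diff_distrib intro: lattice_point_diff)

lemma lattice_point_row_lattice: "int_matrix M \<Longrightarrow> x \<in> row_lattice M \<Longrightarrow> lattice_point x"
  unfolding row_lattice_def using lattice_point_vector_matrix_mult by blast

lemma row_in_row_lattice: "M $ i \<in> row_lattice M"
proof -
  have "M $ i = axis i 1 v* M"
    by (simp flip: transpose_matrix_vector add: matrix_vector_mult_basis column_def transpose_def vec_eq_iff)
  moreover have "lattice_point (axis i (1::real))" by (simp add: lattice_point_def axis_def)
  ultimately show ?thesis unfolding row_lattice_def by blast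
qed

lemma int_matrix_det_Ints: "int_matrix M \<Longrightarrow> det M \<in> \<int>"
  unfolding det_def int_matrix_def by (intro Ints_sum Ints_mult Ints_prod) (auto simp: sign_def)

lemma int_matrix_column_matrix: "(\<And>j. lattice_point (g j)) \<Longrightarrow> int_matrix (column_matrix g)"
  by (simp add: int_matrix_def column_matrix_def lattice_point_def)

lemma inverse_entry_mult_det_Ints:
  assumes "int_matrix M" "M ** C = mat 1"
  shows "C $ i $ j * det M \<in> \<int>"
proof -
  define x where "x = C *v axis j 1"
  have Mx: "M *v x = axis j 1" unfolding x_def by (simp add: matrix_vector_mul_assoc assms(2))
  have "C $ i $ j = x $ i"
    by (simp add: x_def matrix_vector_mult_def axis_def if_distrib cong: if_cong)
  also have "\<dots> * det M = det (\<chi> a b. if b = i then (M *v x) $ a else M $ a $ b)"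
    by (rule cramer_lemma[symmetric])
  finally show ?thesis
    using assms(1) unfolding Mx int_matrix_def by (auto intro!: int_matrix_det_Ints simp: int_matrix_def axis_def)
qed

lemma det_scaleR_in_row_lattice:
  assumes M: "int_matrix M" "det M \<noteq> 0" and z: "lattice_point z"
  shows "det M *\<^sub>R z \<in> row_lattice M"
proof -
  obtain C where C: "M ** C = mat 1" "C ** M = mat 1"
    using M(2) invertible_det_nz[of M] unfolding invertible_def by auto
  define y where "y = (det M *\<^sub>R z) v* C"
  have "y $ j = (\<Sum>i\<in>UNIV. (C $ i $ j * det M) * z $ i)" for j
    by (simp add: y_def vector_matrix_mult_def algebra_simps)
  then have "lattice_point y"
    using inverse_entry_mult_det_Ints[OF M(1) C(1)] z
    by (simp add: lattice_point_def Ints_sum Ints_mult)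
  moreover have "det M *\<^sub>R z = y v* M" by (simp add: y_def vector_matrix_mul_assoc C(2))
  ultimately show ?thesis unfolding row_lattice_def by blast
qed

lemma multiple_in_row_lattice:
  assumes M: "int_matrix M" "det M = of_int k" "k \<noteq> 0" "k dvd K" and x: "lattice_point x"
  shows "of_int K *\<^sub>R x \<in> row_lattice M"
proof -
  obtain l where l: "K = k * l" using assms(4) by blast
  have "lattice_point (of_int l *\<^sub>R x)" using x by (simp add: lattice_point_def)
  then have "det M *\<^sub>R (of_int l *\<^sub>R x) \<in> row_lattice M"
    using M by (intro det_scaleR_in_row_lattice) auto
  then show ?thesis by (simp add: M(2) l)
qed

definition lattice_cube :: "int \<Rightarrow> (real^'n) set" where
  "lattice_cube K = {x. lattice_point x \<and> (\<forall>i. 0 \<le> x $ i \<and> x $ i < of_int K)}"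

text \<open>Reducing coordinates modulo K moves a lattice point into [0, K)^n without leaving any lattice
  that contains K \<int>^n.\<close>

lemma row_lattice_subset_if_cube_eq:
  fixes M M' :: "real^'n::finite^'m::finite"
  assumes M: "int_matrix M" and K: "K > 0"
    and mult: "\<And>x. lattice_point x \<Longrightarrow> of_int K *\<^sub>R x \<in> row_lattice M"
    and mult': "\<And>x. lattice_point x \<Longrightarrow> of_int K *\<^sub>R x \<in> row_lattice M'"
    and eq: "row_lattice M \<inter> lattice_cube K = row_lattice M' \<inter> lattice_cube K"
  shows "row_lattice M \<subseteq> row_lattice M'"
proof
  fix x assume x: "x \<in> row_lattice M"
  define a where "a i = \<lfloor>x $ i\<rfloor>" for i
  have "x $ i = of_int (a i)" for i
    using lattice_point_row_lattice[OF M x] by (simp add: a_def lattice_point_def)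
  moreover define r :: "real^'n" where "r = (\<chi> i. of_int (a i mod K))"
  moreover define q :: "real^'n" where "q = (\<chi> i. of_int (a i div K))"
  ultimately have x_eq: "x = r + of_int K *\<^sub>R q"
    by (simp add: vec_eq_iff flip: of_int_mult of_int_add)
  have "lattice_point q" by (simp add: q_def lattice_point_def)
  then have "r \<in> row_lattice M"
    using row_lattice_diff[OF x mult] x_eq by (metis add_diff_cancel_right')
  moreover have "r \<in> lattice_cube K" using K
    by (simp add: lattice_cube_def r_def lattice_point_def)
  ultimately have "r \<in> row_lattice M'" using eq by blast
  then show "x \<in> row_lattice M'"
    using x_eq row_lattice_add mult' \<open>lattice_point q\<close> by metis
qed

lemma int_matrix_mult_inverse:
  assumes "M ** C = mat 1" and P: "\<And>i. P $ i \<in> row_lattice M"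
  shows "int_matrix (P ** C)"
proof -
  have "(P ** C) $ i $ j \<in> \<int>" for i j
  proof -
    obtain z where z: "lattice_point z" "P $ i = z v* M" using P[of i] unfolding row_lattice_def by blast
    have "(P ** C) $ i = P $ i v* C"
      by (simp add: vec_eq_iff matrix_matrix_mult_def vector_matrix_mult_def mult.commute)
    also have "\<dots> = z" by (simp add: z(2) vector_matrix_mul_assoc assms(1))
    finally show ?thesis using z(1) by (simp add: lattice_point_def)
  qed
  then show ?thesis by (simp add: int_matrix_def)
qed

lemma unimodular_if_row_lattice_eq:
  fixes M M' :: "real^'n::finite^'n"
  assumes "det M \<noteq> 0" "det M' \<noteq> 0" "row_lattice M = row_lattice M'"
  obtains A where "int_matrix A" "\<bar>det A\<bar> = 1" "A ** M = M'"
proof -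
  obtain C where C: "M ** C = mat 1" "C ** M = mat 1"
    using assms(1) invertible_det_nz[of M] unfolding invertible_def by auto
  obtain C' where C': "M' ** C' = mat 1" "C' ** M' = mat 1"
    using assms(2) invertible_det_nz[of M'] unfolding invertible_def by auto
  define A where "A = M' ** C"
  define A' where "A' = M ** C'"
  have int: "int_matrix A" "int_matrix A'"
    unfolding A_def A'_def using assms(3) row_in_row_lattice
    by (auto intro!: int_matrix_mult_inverse C C')
  have AM: "A ** M = M'" by (simp add: A_def matrix_mul_assoc[symmetric] C(2))
  have "A' ** M' = M" by (simp add: A'_def matrix_mul_assoc[symmetric] C'(2))
  then have "det A * det A' * det M = det M"
    using AM det_mul by (metis mult.assoc mult.commute)
  then have one: "\<bar>det A\<bar> * \<bar>det A'\<bar> = 1" using assms(1) by (simp flip: abs_mult)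
  then have "det A \<noteq> 0" "det A' \<noteq> 0" by auto
  then have "1 \<le> \<bar>det A\<bar>" "1 \<le> \<bar>det A'\<bar>"
    using int int_matrix_det_Ints by (auto intro: Ints_nonzero_abs_ge1)
  moreover have "\<bar>det A\<bar> * 1 \<le> \<bar>det A\<bar> * \<bar>det A'\<bar>"
    using \<open>1 \<le> \<bar>det A'\<bar>\<close> by (intro mult_left_mono) auto
  ultimately have "\<bar>det A\<bar> = 1" using one by linarith
  with int(1) AM that show thesis by blast
qed

lemma finite_lattice_points_cube: "finite {y::real^'n::finite. lattice_point y \<and> (\<forall>i. \<bar>y $ i\<bar> \<le> b)}"
proof -
  define N where "N = \<lfloor>b\<rfloor>"
  have "{y::real^'n. lattice_point y \<and> (\<forall>i. \<bar>y $ i\<bar> \<le> b)}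
        \<subseteq> (\<lambda>f. \<chi> i. real_of_int (f i)) ` (PiE UNIV (\<lambda>_. {-N..N}))"
  proof
    fix y :: "real^'n" assume y: "y \<in> {y. lattice_point y \<and> (\<forall>i. \<bar>y $ i\<bar> \<le> b)}"
    define f where "f i = \<lfloor>y $ i\<rfloor>" for i
    have yf: "y $ i = of_int (f i)" for i using y by (simp add: f_def lattice_point_def)
    have "\<bar>f i\<bar> \<le> N" for i using y unfolding N_def by (simp flip: yf add: le_floor_iff)
    then have "f \<in> PiE UNIV (\<lambda>_. {-N..N})"
      by (simp add: PiE_iff abs_le_iff) (metis minus_le_iff)
    moreover have "y = (\<chi> i. real_of_int (f i))" by (simp add: vec_eq_iff yf)
    ultimately show "y \<in> (\<lambda>f. \<chi> i. real_of_int (f i)) ` (PiE UNIV (\<lambda>_. {-N..N}))" by blast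
  qed
  moreover have "finite ((\<lambda>f. \<chi> i. real_of_int (f i)) ` (PiE UNIV (\<lambda>_. {-N..N})))"
    by (intro finite_imageI finite_PiE) auto
  ultimately show ?thesis using finite_subset by blast
qed

lemma dvd_fact_floor:
  fixes k :: int
  assumes "k \<noteq> 0" "\<bar>real_of_int k\<bar> < D"
  shows "k dvd fact (nat \<lfloor>D\<rfloor>)"
proof -
  have "nat \<bar>k\<bar> dvd (fact (nat \<lfloor>D\<rfloor>) :: nat)"
    using assms by (intro dvd_fact) linarith+
  then have "\<bar>k\<bar> dvd fact (nat \<lfloor>D\<rfloor>)"
    by (metis int_dvd_int_iff of_nat_fact zero_le_imp_eq_int abs_ge_zero int_nat_eq)
  then show ?thesis by simp
qed

lemma fact_floor_scaleR_in_row_lattice: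
  assumes M: "int_matrix M" "det M \<noteq> 0" "\<bar>det M\<bar> < D" and x: "lattice_point x"
  shows "of_int (fact (nat \<lfloor>D\<rfloor>)) *\<^sub>R x \<in> row_lattice M"
proof -
  obtain k where k: "det M = of_int k"
    using int_matrix_det_Ints[OF M(1)] by (auto elim: Ints_cases)
  then have "k \<noteq> 0" "k dvd fact (nat \<lfloor>D\<rfloor>)"
    using M dvd_fact_floor by auto
  then show ?thesis
    using multiple_in_row_lattice M(1) k x by blast
qed

lemma finite_unimodular_classes:
  fixes D :: real
  obtains \<M> :: "(real^'n::finite^'n) set" where "finite \<M>"
    "\<And>M. int_matrix M \<Longrightarrow> det M \<noteq> 0 \<Longrightarrow> \<bar>det M\<bar> < D \<Longrightarrow>
      \<exists>M'\<in>\<M>. \<exists>A. int_matrix A \<and> \<bar>det A\<bar> = 1 \<and> A ** M = M'"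
proof -
  define K :: int where "K = fact (nat \<lfloor>D\<rfloor>)"
  define good where "good J M \<longleftrightarrow> int_matrix M \<and> det M \<noteq> 0 \<and> \<bar>det M\<bar> < D \<and> row_lattice M \<inter> lattice_cube K = J"
    for J and M :: "real^'n^'n"
  have K_multiples: "of_int K *\<^sub>R x \<in> row_lattice M" if "good J M" "lattice_point x" for J M x
    using that unfolding good_def K_def by (blast intro: fact_floor_scaleR_in_row_lattice)
  define \<M> where "\<M> = (\<lambda>J. SOME M. good J M) ` Pow (lattice_cube K)"
  have "lattice_cube K \<subseteq> {y::real^'n. lattice_point y \<and> (\<forall>i. \<bar>y $ i\<bar> \<le> of_int K)}"
    by (auto simp: lattice_cube_def abs_of_nonneg less_imp_le)
  then have "finite \<M>"
    unfolding \<M>_def using finite_lattice_points_cube finite_subset by blast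
  moreover have "\<exists>M'\<in>\<M>. \<exists>A. int_matrix A \<and> \<bar>det A\<bar> = 1 \<and> A ** M = M'"
    if M: "int_matrix M" "det M \<noteq> 0" "\<bar>det M\<bar> < D" for M
  proof -
    define J where "J = row_lattice M \<inter> lattice_cube K"
    define M' where "M' = (SOME M. good J M)"
    have good: "good J M" using M by (simp add: good_def J_def)
    then have good': "good J M'" unfolding M'_def by (rule someI)
    have "K > 0" by (simp add: K_def)
    have int: "int_matrix M" "int_matrix M'" and dets: "det M \<noteq> 0" "det M' \<noteq> 0"
      and eq: "row_lattice M \<inter> lattice_cube K = row_lattice M' \<inter> lattice_cube K"
      using good good' by (simp_all add: good_def)
    have "row_lattice M = row_lattice M'"
      using row_lattice_subset_if_cube_eq[OF int(1) \<open>K > 0\<close> K_multiples[OF good] K_multiples[OF good'] eq]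
        row_lattice_subset_if_cube_eq[OF int(2) \<open>K > 0\<close> K_multiples[OF good'] K_multiples[OF good] eq[symmetric]]
      by (rule subset_antisym)
    then obtain A where "int_matrix A" "\<bar>det A\<bar> = 1" "A ** M = M'"
      using unimodular_if_row_lattice_eq dets by blast
    moreover have "M' \<in> \<M>" by (auto simp: \<M>_def M'_def J_def)
    ultimately show ?thesis by blast
  qed
  ultimately show thesis using that by blast
qed

section \<open>Ray generators after a unimodular change of basis\<close>

definition det_bound :: "nat \<Rightarrow> real \<Rightarrow> real" where
  "det_bound d \<epsilon> = fact d * real d ^ d / \<epsilon>"

lemma det_bound_pos: "\<epsilon> > 0 \<Longrightarrow> det_bound d \<epsilon> > 0"
  by (cases d) (simp_all add: det_bound_def)

lemma abs_det_less_if_normalized_volume_gt: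
  fixes \<sigma> :: "(real^'n::finite) set"
  assumes \<epsilon>: "\<epsilon> > 0" "ennreal \<epsilon> < normalized_volume \<sigma>"
    and g: "\<And>i. g i \<in> ray_generators \<sigma>" and det: "det (column_matrix g) \<noteq> 0"
  shows "\<bar>det (column_matrix g)\<bar> < det_bound CARD('n) \<epsilon>"
proof -
  have "ennreal \<epsilon> < ennreal (fact CARD('n) * real CARD('n) ^ CARD('n) / \<bar>det (column_matrix g)\<bar>)"
    using \<epsilon>(2) normalized_volume_le_det[OF g det] by (rule less_le_trans)
  then have "\<epsilon> < fact CARD('n) * real CARD('n) ^ CARD('n) / \<bar>det (column_matrix g)\<bar>"
    using \<epsilon>(1) by (simp add: ennreal_less_iff)
  then show ?thesis
    using \<epsilon>(1) det by (simp add: det_bound_def field_simps)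
qed

text \<open>Cramer's rule: c k = det g' / det g with g' = g(k := w); the denominator is a nonzero
  integer and a nonzero numerator obeys the bound above.\<close>

lemma abs_coordinate_le_if_normalized_volume_gt:
  fixes \<sigma> :: "(real^'n::finite) set"
  assumes \<epsilon>: "\<epsilon> > 0" "ennreal \<epsilon> < normalized_volume \<sigma>"
    and g: "\<And>i. g i \<in> ray_generators \<sigma>" and det: "det (column_matrix g) \<noteq> 0"
    and w: "w \<in> ray_generators \<sigma>" and c: "column_matrix g *v c = w"
  shows "\<bar>c $ k\<bar> \<le> det_bound CARD('n) \<epsilon>"
proof -
  define g' where "g' = g(k := w)"
  have "column_matrix g' = (\<chi> i j. if j = k then (column_matrix g *v c) $ i else column_matrix g $ i $ j)"
    unfolding c by (simp add: vec_eq_iff column_matrix_def g'_def)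
  then have cramer: "det (column_matrix g') = c $ k * det (column_matrix g)"
    by (simp only: cramer_lemma)
  show ?thesis
  proof (cases "det (column_matrix g') = 0")
    case True
    then show ?thesis using cramer det less_imp_le[OF det_bound_pos[OF \<epsilon>(1)]] by simp
  next
    case False
    have "int_matrix (column_matrix g)"
      using g lattice_point_ray_generator by (blast intro: int_matrix_column_matrix)
    then have "1 \<le> \<bar>det (column_matrix g)\<bar>"
      using det int_matrix_det_Ints by (blast intro: Ints_nonzero_abs_ge1)
    then have "\<bar>c $ k\<bar> \<le> \<bar>det (column_matrix g')\<bar>"
      by (simp add: cramer abs_mult mult_le_cancel_left1)
    also have "\<dots> < det_bound CARD('n) \<epsilon>"
      using g w False by (intro abs_det_less_if_normalized_volume_gt[OF \<epsilon>]) (auto simp: g'_def)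
    finally show ?thesis by simp
  qed
qed

lemma abs_matrix_vector_mult_le:
  fixes M :: "real^'n::finite^'m::finite"
  assumes c: "\<And>j. \<bar>c $ j\<bar> \<le> D"
  shows "\<bar>(M *v c) $ i\<bar> \<le> D * (\<Sum>i\<in>UNIV. \<Sum>j\<in>UNIV. \<bar>M $ i $ j\<bar>)"
proof -
  have "D \<ge> 0" using c order_trans abs_ge_zero by blast
  have "\<bar>(M *v c) $ i\<bar> \<le> (\<Sum>j\<in>UNIV. \<bar>M $ i $ j * c $ j\<bar>)"
    unfolding matrix_vector_mult_def by (simp add: sum_abs)
  also have "\<dots> \<le> (\<Sum>j\<in>UNIV. \<bar>M $ i $ j\<bar> * D)"
    by (intro sum_mono) (simp add: abs_mult c mult_left_mono)
  also have "\<dots> = D * (\<Sum>j\<in>UNIV. \<bar>M $ i $ j\<bar>)" by (simp add: sum_distrib_left mult.commute)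
  also have "\<dots> \<le> D * (\<Sum>i\<in>UNIV. \<Sum>j\<in>UNIV. \<bar>M $ i $ j\<bar>)"
    using \<open>D \<ge> 0\<close> by (intro mult_left_mono member_le_sum) (auto intro: sum_nonneg)
  finally show ?thesis .
qed

lemma matrix_image_of_ray_generator_bounded:
  fixes \<sigma> :: "(real^'n::finite) set"
  assumes \<epsilon>: "\<epsilon> > 0" "ennreal \<epsilon> < normalized_volume \<sigma>"
    and g: "\<And>i. g i \<in> ray_generators \<sigma>" and det: "det (column_matrix g) \<noteq> 0"
    and A: "int_matrix A" "A ** column_matrix g = M'" and w: "w \<in> ray_generators \<sigma>"
  shows "lattice_point (A *v w)"
    and "\<bar>(A *v w) $ i\<bar> \<le> det_bound CARD('n) \<epsilon> * (\<Sum>i\<in>UNIV. \<Sum>j\<in>UNIV. \<bar>M' $ i $ j\<bar>)"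
proof -
  obtain C where C: "column_matrix g ** C = mat 1"
    using det invertible_det_nz unfolding invertible_def by blast
  define c where "c = C *v w"
  have c: "column_matrix g *v c = w" by (simp add: c_def matrix_vector_mul_assoc C)
  show "lattice_point (A *v w)"
    using lattice_point_matrix_vector_mult[OF A(1) lattice_point_ray_generator[OF w]] .
  have "A *v w = M' *v c" using A(2) c by (metis matrix_vector_mul_assoc)
  then show "\<bar>(A *v w) $ i\<bar> \<le> det_bound CARD('n) \<epsilon> * (\<Sum>i\<in>UNIV. \<Sum>j\<in>UNIV. \<bar>M' $ i $ j\<bar>)"
    using abs_matrix_vector_mult_le abs_coordinate_le_if_normalized_volume_gt[OF \<epsilon> g det w c] by metis
qed

lemma ex_toric_iso_cone_in_lattice_box:
  fixes \<sigma> :: "(real^'n::finite) set" and \<M> :: "(real^'n^'n) set"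
  assumes \<epsilon>: "\<epsilon> > 0" and \<sigma>: "toric_cone \<sigma>" "ennreal \<epsilon> < normalized_volume \<sigma>"
    and "finite \<M>"
    and classes: "\<And>M. int_matrix M \<Longrightarrow> det M \<noteq> 0 \<Longrightarrow> \<bar>det M\<bar> < det_bound CARD('n) \<epsilon> \<Longrightarrow>
      \<exists>M'\<in>\<M>. \<exists>A. int_matrix A \<and> \<bar>det A\<bar> = 1 \<and> A ** M = M'"
  obtains T where "T \<subseteq> {y. lattice_point y \<and>
      (\<forall>i. \<bar>y $ i\<bar> \<le> det_bound CARD('n) \<epsilon> * (\<Sum>M'\<in>\<M>. \<Sum>i\<in>UNIV. \<Sum>j\<in>UNIV. \<bar>M' $ i $ j\<bar>))}"
    "toric_iso \<sigma> (convex_cone hull T)"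
proof -
  obtain g where g: "\<And>i. g i \<in> ray_generators \<sigma>" "det (column_matrix g) \<noteq> 0"
    using ex_invertible_column_matrix[OF span_ray_generators[OF \<sigma>(1)]] by blast
  have "int_matrix (column_matrix g)"
    using g(1) lattice_point_ray_generator by (blast intro: int_matrix_column_matrix)
  then obtain M' A where A: "M' \<in> \<M>" "int_matrix A" "\<bar>det A\<bar> = 1" "A ** column_matrix g = M'"
    using classes g(2) abs_det_less_if_normalized_volume_gt[OF \<epsilon> \<sigma>(2) g] by blast
  have "(\<Sum>i\<in>UNIV. \<Sum>j\<in>UNIV. \<bar>M' $ i $ j\<bar>) \<le> (\<Sum>M''\<in>\<M>. \<Sum>i\<in>UNIV. \<Sum>j\<in>UNIV. \<bar>M'' $ i $ j\<bar>)"
    using A(1) \<open>finite \<M>\<close> by (intro member_le_sum) (auto intro: sum_nonneg)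
  then have bound: "det_bound CARD('n) \<epsilon> * (\<Sum>i\<in>UNIV. \<Sum>j\<in>UNIV. \<bar>M' $ i $ j\<bar>)
      \<le> det_bound CARD('n) \<epsilon> * (\<Sum>M''\<in>\<M>. \<Sum>i\<in>UNIV. \<Sum>j\<in>UNIV. \<bar>M'' $ i $ j\<bar>)"
    using det_bound_pos[OF \<epsilon>] by (simp add: mult_left_mono)
  have "(*v) A ` \<sigma> = convex_cone hull ((*v) A ` ray_generators \<sigma>)"
    using convex_cone_hull_linear_image[OF matrix_vector_mul_linear[of A], of "ray_generators \<sigma>"]
    by (simp add: toric_cone_ray_generators_hull[OF \<sigma>(1)])
  then have "toric_iso \<sigma> (convex_cone hull ((*v) A ` ray_generators \<sigma>))"
    unfolding toric_iso_def using A(2,3) by (auto simp: int_matrix_def)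
  moreover have "(*v) A ` ray_generators \<sigma> \<subseteq> {y. lattice_point y \<and>
      (\<forall>i. \<bar>y $ i\<bar> \<le> det_bound CARD('n) \<epsilon> * (\<Sum>M'\<in>\<M>. \<Sum>i\<in>UNIV. \<Sum>j\<in>UNIV. \<bar>M' $ i $ j\<bar>))}"
  proof (rule image_subsetI)
    fix w assume w: "w \<in> ray_generators \<sigma>"
    have "\<bar>(A *v w) $ i\<bar> \<le> det_bound CARD('n) \<epsilon> * (\<Sum>M'\<in>\<M>. \<Sum>i\<in>UNIV. \<Sum>j\<in>UNIV. \<bar>M' $ i $ j\<bar>)" for i
      using matrix_image_of_ray_generator_bounded(2)[OF \<epsilon> \<sigma>(2) g A(2,4) w] bound by (rule order_trans)
    with matrix_image_of_ray_generator_bounded(1)[OF \<epsilon> \<sigma>(2) g A(2,4) w]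
    show "A *v w \<in> {y. lattice_point y \<and>
      (\<forall>i. \<bar>y $ i\<bar> \<le> det_bound CARD('n) \<epsilon> * (\<Sum>M'\<in>\<M>. \<Sum>i\<in>UNIV. \<Sum>j\<in>UNIV. \<bar>M' $ i $ j\<bar>))}"
      by blast
  qed
  ultimately show thesis using that by blast
qed

theorem corollary3p6:
  fixes \<epsilon> :: real
  assumes "\<epsilon> > 0"
  shows "\<exists>F :: (real^'n::finite) set set. finite F \<and>
           (\<forall>\<sigma>. toric_cone \<sigma> \<and> Q_Gorenstein \<sigma> \<and> ennreal \<epsilon> < normalized_volume \<sigma>
                 \<longrightarrow> (\<exists>\<tau>\<in>F. toric_iso \<sigma> \<tau>))"
proof -
  obtain \<M> :: "(real^'n^'n) set" where "finite \<M>" and classes: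
    "\<And>M. int_matrix M \<Longrightarrow> det M \<noteq> 0 \<Longrightarrow> \<bar>det M\<bar> < det_bound CARD('n) \<epsilon> \<Longrightarrow>
      \<exists>M'\<in>\<M>. \<exists>A. int_matrix A \<and> \<bar>det A\<bar> = 1 \<and> A ** M = M'"
    using finite_unimodular_classes by blast
  define G where "G = {y::real^'n. lattice_point y \<and>
      (\<forall>i. \<bar>y $ i\<bar> \<le> det_bound CARD('n) \<epsilon> * (\<Sum>M'\<in>\<M>. \<Sum>i\<in>UNIV. \<Sum>j\<in>UNIV. \<bar>M' $ i $ j\<bar>))}"
  have "finite ((\<lambda>T. convex_cone hull T) ` Pow G)"
    unfolding G_def by (intro finite_imageI) (simp add: finite_lattice_points_cube)
  moreover have "\<exists>\<tau> \<in> (\<lambda>T. convex_cone hull T) ` Pow G. toric_iso \<sigma> \<tau>"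
    if \<sigma>: "toric_cone \<sigma>" "ennreal \<epsilon> < normalized_volume \<sigma>" for \<sigma>
  proof -
    obtain T where "T \<subseteq> G" "toric_iso \<sigma> (convex_cone hull T)"
      using ex_toric_iso_cone_in_lattice_box[OF assms \<sigma> \<open>finite \<M>\<close> classes] unfolding G_def .
    then show ?thesis by blast
  qed
  ultimately show ?thesis by blast
qed

end
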